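(* Let $T$ be an oscillatory tetradiagonal Hessenberg matrix. Define tetradiagonal Hessenberg matrices as follows (all with first superdiagonal of ones and zero entries outside the displayed bands). $T^{(2)}$ has diagonal $\bigl(c_1-\tfrac{b_1}{c_0},\,c_2,\,c_3,\,c_4,\dots\bigr)$, first subdiagonal $\bigl(b_2-\tfrac{a_2}{c_0},\,b_3,\,b_4,\dots\bigr)$ and second subdiagonal $(a_3,a_4,a_5,\dots)$. For $k\in\{2,3,\dots\}$, $T^{(k+1)}$ has diagonal $(\alpha_{3k+1},\,c_{k+1},\,c_{k+2},\,c_{k+3},\dots)$, first subdiagonal $\bigl((c_{k+1}-\alpha_{3k+4})\alpha_{3k+1},\,b_{k+2},\,b_{k+3},\dots\bigr)$ and second subdiagonal $(a_{k+2},a_{k+3},a_{k+4},\dots)$. Then $T^{(2)}$ and $T^{(k+1)}$, $k\in\{2,3,\dots\}$, have a PBF, with associated infinite continued fractions equal to the tails $\mathcal K[2]$ and $\mathcal K[k+1]$, respectively, of the infinite continued fraction $\mathcal K[1]$ of $T$.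
   Context: A tetradiagonal Hessenberg matrix is a real semi-infinite matrix $T=(T_{i,j})_{i,j\ge0}$ with $T_{n,n+1}=1$, $T_{n,n}=c_n$ ($n\ge0$), $T_{n,n-1}=b_n$ ($n\ge1$), $T_{n,n-2}=a_n$ ($n\ge2$), all other entries $0$, and $a_n>0$ for all $n\ge2$. $T^{[N]}$ is the leading principal submatrix with rows and columns $0,\dots,N$. A finite matrix is TN if all its minors are nonnegative, and oscillatory if it is TN and some power of it has all minors positive (equivalently, TN, irreducible and nonsingular). A semi-infinite matrix is oscillatory if all its leading principal submatrices are. A PBF (positive bidiagonal factorization) of $T$ is a factorization $T=L_1L_2U$ where $L_1$ is lower unitriangular bidiagonal with first subdiagonal $(\alpha_2,\alpha_5,\alpha_8,\dots)$, $L_2$ is lower unitriangular bidiagonal with first subdiagonal $(\alpha_3,\alpha_6,\alpha_9,\dots)$, $U$ is upper bidiagonal with diagonal $(\alpha_1,\alpha_4,\alpha_7,\dots)$ and first superdiagonal of ones, and $\alpha_j>0$ for all $j\in\mathbb N$. A matrix admitting a PBF is oscillatory. For $T$ oscillatory let $\delta^{[n]}=\det T^{[n]}>0$, $\delta^{[-1]}=1$. The Gauss--Borel factorization is the unique factorization $T=LU$ with $U$ upper bidiagonal with first superdiagonal of ones and diagonal $(\alpha_1,\alpha_4,\alpha_7,\dots)$, and $L$ lower unitriangular with $L_{n,n-1}=m_n$ ($n\ge1$), $L_{n,n-2}=l_n$ ($n\ge2$), other subdiagonal entries zero; explicitly $\alpha_{3n+1}=\delta^{[n]}/\delta^{[n-1]}$,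 $m_n=c_n-\alpha_{3n+1}$, $l_n=a_n/\alpha_{3n-5}$. In the claim, the $\alpha_{3k+1}$ are those of the Gauss--Borel factorization of $T$. For $n\ge k\ge1$ let $$\mathcal K[n,k]=m_k-\cfrac{l_{k+1}}{m_{k+1}-\cfrac{l_{k+2}}{\ddots-\cfrac{l_n}{m_n}}},\qquad \mathcal K[k,k]=m_k,$$ and let $\mathcal K[k]=\lim_{n\to\infty}\mathcal K[n,k]$ (these limits exist). $\mathcal K[1]$ is the infinite continued fraction associated with $T$, and $\mathcal K[2],\mathcal K[3],\dots$ are its tails. The infinite continued fraction associated with another oscillatory tetradiagonal Hessenberg matrix is constructed in the same way from that matrix's own Gauss--Borel factorization. *)

theory Defs
  imports Complex_Main
    "Jordan_Normal_Form.Determinant"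
    "Jordan_Normal_Form.DL_Submatrix"
begin

section \<open>Semi-infinite matrices\<close>

type_synonym smat = "nat \<Rightarrow> nat \<Rightarrow> real"

text \<open>All products formed below have rows of finite support on the left, so that the series are
  finite sums.\<close>

definition smat_mult :: "smat \<Rightarrow> smat \<Rightarrow> smat" (infixl "\<cdot>" 70) where
  "A \<cdot> B = (\<lambda>i j. \<Sum>k. A i k * B k j)"

text \<open>The values \<open>b 0\<close>, \<open>a 0\<close>, \<open>a 1\<close> are not used: every coefficient carries the
  index of its row.\<close>

definition tetra_hess :: "(nat \<Rightarrow> real) \<Rightarrow> (nat \<Rightarrow> real) \<Rightarrow> (nat \<Rightarrow> real) \<Rightarrow> smat" where
  "tetra_hess a b c = (\<lambda>i j.
     if j = i + 1 then 1
     else if j = i then c i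
     else if i = j + 1 then b i
     else if i = j + 2 then a i
     else 0)"

definition lower_unitri :: "(nat \<Rightarrow> real) \<Rightarrow> (nat \<Rightarrow> real) \<Rightarrow> smat" where
  "lower_unitri m l = (\<lambda>i j.
     if i = j then 1
     else if i = j + 1 then m i
     else if i = j + 2 then l i
     else 0)"

definition lower_bidiag :: "(nat \<Rightarrow> real) \<Rightarrow> smat" where
  "lower_bidiag m = (\<lambda>i j. if i = j then 1 else if i = j + 1 then m i else 0)"

definition upper_bidiag :: "(nat \<Rightarrow> real) \<Rightarrow> smat" where
  "upper_bidiag d = (\<lambda>i j. if i = j then d i else if j = i + 1 then 1 else 0)"

text \<open>The leading principal submatrix of order \<open>n\<close> (rows and columns \<open>0, \<dots>, n - 1\<close>); thus
  \<open>T\<^sup>[\<^sup>N\<^sup>]\<close> is the section of order \<open>N + 1\<close>.\<close>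

definition leading :: "smat \<Rightarrow> nat \<Rightarrow> real mat" where
  "leading T n = mat n n (\<lambda>(i, j). T i j)"


section \<open>Total nonnegativity, oscillatory matrices, positive bidiagonal factorizations\<close>

definition TN :: "real mat \<Rightarrow> bool" where
  "TN A \<longleftrightarrow> (\<forall>I J. I \<subseteq> {..<dim_row A} \<longrightarrow> J \<subseteq> {..<dim_col A} \<longrightarrow> card I = card J \<longrightarrow>
     det (submatrix A I J) \<ge> 0)"

definition TP :: "real mat \<Rightarrow> bool" where
  "TP A \<longleftrightarrow> (\<forall>I J. I \<subseteq> {..<dim_row A} \<longrightarrow> J \<subseteq> {..<dim_col A} \<longrightarrow> card I = card J \<longrightarrow>
     det (submatrix A I J) > 0)"

text \<open>The exponent must be positive, since the zeroth power of any matrix of order 1 is TP.\<close>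

definition oscillatory_mat :: "real mat \<Rightarrow> bool" where
  "oscillatory_mat A \<longleftrightarrow> square_mat A \<and> TN A \<and> (\<exists>k\<ge>1. TP (A ^\<^sub>m k))"

definition oscillatory :: "smat \<Rightarrow> bool" where
  "oscillatory T \<longleftrightarrow> (\<forall>N. oscillatory_mat (leading T (Suc N)))"

text \<open>In \<open>lower_bidiag m\<close> the first subdiagonal is \<open>m 1, m 2, \<dots>\<close>, whereas the
  diagonal of \<open>upper_bidiag d\<close> is \<open>d 0, d 1, \<dots>\<close>.\<close>

definition has_PBF :: "smat \<Rightarrow> bool" where
  "has_PBF T \<longleftrightarrow> (\<exists>\<alpha> :: nat \<Rightarrow> real. (\<forall>j\<ge>1. \<alpha> j > 0) \<and>
     T = lower_bidiag (\<lambda>n. \<alpha> (3 * n - 1)) \<cdot> lower_bidiag (\<lambda>n. \<alpha> (3 * n)) \<cdot>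
         upper_bidiag (\<lambda>n. \<alpha> (3 * n + 1)))"


section \<open>Gauss--Borel factorization\<close>

text \<open>\<open>gb_diag T n\<close> is \<open>\<alpha>\<close> at index \<open>3 n + 1\<close>, that is, the quotient of the determinants of the
  sections of orders \<open>n + 1\<close> and \<open>n\<close> (the section of order 0 has determinant 1). Hence
  \<open>\<alpha>\<close> at index \<open>3 n - 5\<close> is \<open>gb_diag T (n - 2)\<close>.\<close>

definition gb_diag :: "smat \<Rightarrow> nat \<Rightarrow> real" where
  "gb_diag T n = det (leading T (Suc n)) / det (leading T n)"

definition gb_m :: "smat \<Rightarrow> nat \<Rightarrow> real" where
  "gb_m T n = T n n - gb_diag T n"

definition gb_l :: "smat \<Rightarrow> nat \<Rightarrow> real" where
  "gb_l T n = T n (n - 2) / gb_diag T (n - 2)"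

lemma suminf_finite_support:
  fixes f :: "nat \<Rightarrow> real"
  assumes "finite S" "\<And>k. k \<notin> S \<Longrightarrow> f k = 0"
  shows "(\<Sum>k. f k) = sum f S"
  using suminf_finite[of S f] assms by auto

lemma lower_upper_entry:
  "(lower_unitri m l \<cdot> upper_bidiag d) i j =
     (if j = i + 1 then 1
      else if j = i then (if i = 0 then 0 else m i) + d i
      else if i = j + 1 then m i * d j + (if j = 0 then 0 else l i)
      else if i = j + 2 then l i * d j
      else 0)"
proof -
  have "(lower_unitri m l \<cdot> upper_bidiag d) i j =
      (\<Sum>k\<in>(if j = 0 then {0} else {j - 1, j}). lower_unitri m l i k * upper_bidiag d k j)"
    unfolding smat_mult_def
    by (rule suminf_finite_support) (auto simp: upper_bidiag_def split: if_splits)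
  also have "\<dots> = (if j = i + 1 then 1
      else if j = i then (if i = 0 then 0 else m i) + d i
      else if i = j + 1 then m i * d j + (if j = 0 then 0 else l i)
      else if i = j + 2 then l i * d j
      else 0)"
    by (cases j) (auto simp: lower_unitri_def upper_bidiag_def)
  finally show ?thesis .
qed

lemma det_leading_lower_upper:
  "det (leading (lower_unitri m l \<cdot> upper_bidiag d) n) = (\<Prod>i<n. d i)"
proof -
  let ?L = "leading (lower_unitri m l) n" and ?U = "leading (upper_bidiag d) n"
  have LU: "leading (lower_unitri m l \<cdot> upper_bidiag d) n = ?L * ?U"
  proof (rule eq_matI)
    fix i j assume "i < dim_row (?L * ?U)" "j < dim_col (?L * ?U)"
    then have ij: "i < n" "j < n" by (auto simp: leading_def)
    have "(lower_unitri m l \<cdot> upper_bidiag d) i j =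
        (\<Sum>k\<in>{0..<n}. lower_unitri m l i k * upper_bidiag d k j)"
      unfolding smat_mult_def
      using ij by (intro suminf_finite_support) (auto simp: upper_bidiag_def lower_unitri_def)
    then show "leading (lower_unitri m l \<cdot> upper_bidiag d) n $$ (i, j) = (?L * ?U) $$ (i, j)"
      using ij by (simp add: leading_def scalar_prod_def)
  qed (auto simp: leading_def)
  have c: "?L \<in> carrier_mat n n" "?U \<in> carrier_mat n n" by (auto simp: leading_def)
  have "det ?L = prod_list (diag_mat ?L)"
    by (rule det_lower_triangular[OF _ c(1)]) (auto simp: leading_def lower_unitri_def)
  also have "\<dots> = 1"
    by (simp add: prod_list_diag_prod leading_def lower_unitri_def)
  finally have 1: "det ?L = 1" .
  have "det ?U = prod_list (diag_mat ?U)"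
    by (rule det_upper_triangular[OF _ c(2)]) (auto simp: leading_def upper_bidiag_def)
  also have "\<dots> = (\<Prod>i<n. d i)"
    by (simp add: prod_list_diag_prod leading_def upper_bidiag_def lessThan_atLeast0)
  finally show ?thesis using 1 LU det_mult[OF c] by simp
qed

text \<open>If a tetradiagonal Hessenberg matrix has a factorization of the Gauss--Borel shape with
  nonvanishing pivots, its entries are given by the formulas above.\<close>

lemma gauss_borel_unique:
  assumes T: "T = tetra_hess a b c" "T = lower_unitri m l \<cdot> upper_bidiag d"
    and d: "\<And>n. d n \<noteq> 0"
  shows "d n = gb_diag T n" "n \<ge> 1 \<Longrightarrow> m n = gb_m T n" "n \<ge> 2 \<Longrightarrow> l n = gb_l T n"
proof -
  have d_eq: "d k = gb_diag T k" for k
    using d unfolding gb_diag_def T(2) det_leading_lower_upper by simp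
  show "d n = gb_diag T n" by (rule d_eq)
  show "m n = gb_m T n" if "n \<ge> 1"
  proof -
    have "T n n = m n + d n" using that unfolding T(2) lower_upper_entry by simp
    then show ?thesis by (simp add: gb_m_def d_eq)
  qed
  show "l n = gb_l T n" if "n \<ge> 2"
  proof -
    have "T n (n - 2) = l n * d (n - 2)" using that unfolding T(2) lower_upper_entry by auto
    then show ?thesis using d[of "n - 2"] by (simp add: gb_l_def d_eq)
  qed
qed

fun gb_pivot :: "(nat \<Rightarrow> real) \<Rightarrow> (nat \<Rightarrow> real) \<Rightarrow> (nat \<Rightarrow> real) \<Rightarrow> nat \<Rightarrow> real" where
  "gb_pivot a b c 0 = c 0"
| "gb_pivot a b c (Suc 0) = c 1 - b 1 / gb_pivot a b c 0"
| "gb_pivot a b c (Suc (Suc n)) = c (n + 2) -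
     (b (n + 2) - a (n + 2) / gb_pivot a b c n) / gb_pivot a b c (Suc n)"

text \<open>Conversely, the factorization exists as soon as no leading principal minor vanishes.\<close>

lemma gauss_borel_factorization:
  assumes T: "T = tetra_hess a b c" and nz: "\<And>n. det (leading T n) \<noteq> 0"
  shows "T = lower_unitri (gb_m T) (gb_l T) \<cdot> upper_bidiag (gb_diag T)"
proof -
  define m where "m = (\<lambda>n. (b n - (if n = 1 then 0 else a n / gb_pivot a b c (n - 2))) /
    gb_pivot a b c (n - 1))"
  define l where "l = (\<lambda>n. a n / gb_pivot a b c (n - 2))"
  let ?d = "gb_pivot a b c"
  let ?LU = "lower_unitri m l \<cdot> upper_bidiag ?d"
  have dm: "(if i = 0 then 0 else m i) + ?d i = c i" for i
    by (cases "(a, b, c, i)" rule: gb_pivot.cases) (auto simp: m_def)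
  have entry: "T i j = ?LU i j" if "\<And>k. k < i \<Longrightarrow> ?d k \<noteq> 0" for i j
  proof -
    consider "j = i + 1" | "j = i" | "i = j + 1" | "i = j + 2" | "j > i + 1" | "i > j + 2"
      by linarith
    then show ?thesis
    proof cases
      case 2
      then show ?thesis using dm[of i] by (simp add: T tetra_hess_def lower_upper_entry)
    next
      case 3
      then have "?d j \<noteq> 0" using that by simp
      with 3 show ?thesis by (auto simp: T tetra_hess_def lower_upper_entry m_def l_def)
    next
      case 4
      then have "?d j \<noteq> 0" using that by simp
      with 4 show ?thesis by (auto simp: T tetra_hess_def lower_upper_entry l_def)
    qed (auto simp: T tetra_hess_def lower_upper_entry)
  qed
  have d: "?d n \<noteq> 0" for n
  proof (induction n rule: less_induct)
    case (less n)
    have "leading T (Suc n) = leading ?LU (Suc n)"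
      unfolding leading_def by (rule cong_mat) (auto intro!: entry less)
    then have "(\<Prod>i<Suc n. ?d i) \<noteq> 0"
      using nz[of "Suc n"] by (simp add: det_leading_lower_upper)
    then show ?case by simp
  qed
  have LU: "T = ?LU" by (intro ext entry d)
  note u = gauss_borel_unique[OF T LU d]
  show ?thesis
    by (subst LU, intro ext) (auto simp: lower_upper_entry u[symmetric])
qed


section \<open>Continued fractions\<close>

text \<open>\<open>cfrac T n k\<close> is \<open>\<K>[n,k]\<close>; only the arguments \<open>n \<ge> k \<ge> 1\<close> matter.\<close>

function cfrac :: "smat \<Rightarrow> nat \<Rightarrow> nat \<Rightarrow> real" where
  "cfrac T n k =
     (if n \<le> k then gb_m T k else gb_m T k - gb_l T (k + 1) / cfrac T n (k + 1))"
  by pat_completeness auto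
termination
  by (relation "measure (\<lambda>(T, n, k). n - k)") auto

declare cfrac.simps [simp del]

definition cfrac_lim :: "smat \<Rightarrow> nat \<Rightarrow> real" where
  "cfrac_lim T k = lim (\<lambda>n. cfrac T n k)"


section \<open>The matrices obtained from \<open>T\<close>\<close>

text \<open>\<open>tail_first a b c\<close> is \<open>T\<^sup>(\<^sup>2\<^sup>)\<close>.\<close>

definition tail_first :: "(nat \<Rightarrow> real) \<Rightarrow> (nat \<Rightarrow> real) \<Rightarrow> (nat \<Rightarrow> real) \<Rightarrow> smat" where
  "tail_first a b c = tetra_hess
     (\<lambda>n. a (n + 1))
     (\<lambda>n. if n = 1 then b 2 - a 2 / c 0 else b (n + 1))
     (\<lambda>n. if n = 0 then c 1 - b 1 / c 0 else c (n + 1))"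

text \<open>\<open>tail_next a b c k\<close> is \<open>T\<^sup>(\<^sup>k\<^sup>+\<^sup>1\<^sup>)\<close>, for \<open>k \<ge> 2\<close>. Here \<open>gb_diag T k\<close> and
  \<open>gb_diag T (k + 1)\<close> are \<open>\<alpha>\<close> at the indices \<open>3 k + 1\<close> and \<open>3 k + 4\<close>.\<close>

definition tail_next :: "(nat \<Rightarrow> real) \<Rightarrow> (nat \<Rightarrow> real) \<Rightarrow> (nat \<Rightarrow> real) \<Rightarrow> nat \<Rightarrow> smat" where
  "tail_next a b c k = (let T = tetra_hess a b c in tetra_hess
     (\<lambda>n. a (n + k))
     (\<lambda>n. if n = 1 then (c (k + 1) - gb_diag T (k + 1)) * gb_diag T k else b (n + k))
     (\<lambda>n. if n = 0 then gb_diag T k else c (n + k)))"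

end

theory Submission
  imports Defs
begin

text \<open>Cauchy--Binet for \<open>T = L U\<close> identifies the minors of \<open>T\<close> with rows \<open>{0, \<dots>, n} - {k - 1}\<close> and
  columns \<open>{0, \<dots>, n - 1}\<close>, up to a positive factor, with the continuants of
  \<open>m\<^sub>k, \<dots>, m\<^sub>n\<close> and \<open>l\<^sub>k\<^sub>+\<^sub>1, \<dots>, l\<^sub>n\<close>. Hence these are nonnegative, and the three-term recurrence
  with \<open>l > 0\<close> makes them strictly positive. So \<open>\<K>[n,k]\<close>, a quotient of continuants, is positive; it
  decreases in \<open>n\<close>, and \<open>\<K>[k] = m\<^sub>k - l\<^sub>k\<^sub>+\<^sub>1 / \<K>[k+1]\<close> with \<open>\<K>[k+1] > 0\<close> for \<open>k \<ge> 1\<close>.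
  The matrix \<open>T\<^sup>(\<^sup>s\<^sup>+\<^sup>1\<^sup>)\<close> has the Gauss--Borel factorization of \<open>T\<close> with all indices shifted by \<open>s\<close>,
  and \<open>\<alpha>\<^sub>3\<^sub>n\<^sub>-\<^sub>1 = \<K>[n+s]\<close>, \<open>\<alpha>\<^sub>3\<^sub>n = l\<^sub>n\<^sub>+\<^sub>s\<^sub>+\<^sub>1 / \<K>[n+s+1]\<close> factorizes its lower factor.\<close>

section \<open>Leading sections and minors\<close>

lemma leading_carrier [simp]: "leading A n \<in> carrier_mat n n"
  by (simp add: leading_def)

text \<open>\<open>pick\<close> enumerates a set in increasing order, hence runs through the image
  of an increasing \<open>r\<close> as \<open>r 0, r 1, ...\<close>. A minor on initial columns thus
  becomes the determinant of a leading section with reindexed rows.\<close>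

lemma submatrix_leading:
  fixes r :: "nat \<Rightarrow> nat"
  assumes r: "strict_mono r" and bound: "\<And>i. i < n \<Longrightarrow> r i < N"
  shows "submatrix (leading A N) (r ` {..<n}) {..<n} = leading (\<lambda>i. A (r i)) n"
proof -
  have pick_image: "pick (f ` {..<n}) i = f i" if "strict_mono f" "i < n" for f :: "nat \<Rightarrow> nat" and i
  proof -
    have "{a \<in> f ` {..<n}. a < f i} = f ` {..<i}"
      using that by (auto simp: strict_mono_less)
    moreover have "card (f ` {..<i}) = i"
      using that by (simp add: card_image strict_mono_imp_inj_on)
    ultimately show ?thesis
      using pick_card_in_set[of "f i" "f ` {..<n}"] that by simp
  qed
  have n: "n \<le> N"
  proof (cases n)
    case (Suc p)
    then show ?thesis using bound[of p] strict_mono_imp_increasing[OF r, of p] by simp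
  qed simp
  have rows: "{i. i < N \<and> i \<in> r ` {..<n}} = r ` {..<n}" using bound by auto
  have cols: "{i. i < N \<and> i < n} = {..<n}" using n by auto
  have "card (r ` {..<n}) = n" using r by (simp add: card_image strict_mono_imp_inj_on)
  moreover have "pick {..<n} j = j" if "j < n" for j
    using pick_image[of id j] that by (simp add: strict_mono_def)
  ultimately show ?thesis
    using n bound by (auto intro!: eq_matI simp: submatrix_def leading_def rows cols pick_image[OF r])
qed

lemma TN_leading_det_nonneg:
  fixes r :: "nat \<Rightarrow> nat"
  assumes "TN (leading A N)" "strict_mono r" "\<And>i. i < n \<Longrightarrow> r i < N"
  shows "det (leading (\<lambda>i. A (r i)) n) \<ge> 0"
proof -
  have c: "card (r ` {..<n}) = n"
    using assms(2) by (simp add: card_image strict_mono_imp_inj_on)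
  have sub: "r ` {..<n} \<subseteq> {..<N}" using assms(3) by auto
  have "n \<le> N" using card_mono[OF _ sub] c by simp
  then have "det (submatrix (leading A N) (r ` {..<n}) {..<n}) \<ge> 0"
    using assms(1) sub c unfolding TN_def by (simp add: leading_def)
  then show ?thesis by (simp add: submatrix_leading[OF assms(2,3)])
qed

lemma det_pow_mat:
  fixes A :: "'a :: comm_ring_1 mat"
  assumes "A \<in> carrier_mat n n"
  shows "det (A ^\<^sub>m k) = det A ^ k"
proof (induction k)
  case (Suc k)
  then show ?case using assms det_mult[OF pow_carrier_mat[OF assms] assms, of k] by simp
qed (use assms in simp)

text \<open>Total nonnegativity makes the determinant at least 0. Its \<open>k\<close>-th power is a
  minor of a totally positive matrix for some \<open>k \<ge> 1\<close>, which excludes 0.\<close>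

lemma oscillatory_det_pos:
  assumes "oscillatory A"
  shows "det (leading A n) > 0"
proof (cases n)
  case 0
  then show ?thesis by (simp add: leading_def)
next
  case (Suc N)
  let ?B = "leading A n"
  obtain k where k: "k \<ge> 1" and TN: "TN ?B" and TP: "TP (?B ^\<^sub>m k)"
    using assms Suc unfolding oscillatory_def oscillatory_mat_def by blast
  let ?C = "?B ^\<^sub>m k"
  have C: "?C \<in> carrier_mat n n" by (rule pow_carrier_mat) simp
  then have dim: "dim_row ?C = n" "dim_col ?C = n" by (rule carrier_matD)+
  have "?C = leading (\<lambda>i j. ?C $$ (i, j)) n" using C by (auto simp: leading_def)
  then have "submatrix ?C {..<n} {..<n} = ?C"
    using submatrix_leading[of id n n "\<lambda>i j. ?C $$ (i, j)"] by (simp add: strict_mono_def)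
  moreover have "det (submatrix ?C {..<n} {..<n}) > 0"
    using TP unfolding TP_def dim by blast
  ultimately have "det ?B ^ k > 0" using det_pow_mat[of ?B n k] by simp
  moreover have "det ?B \<ge> 0"
    using TN_leading_det_nonneg[OF TN, of id n] by (simp add: strict_mono_def)
  ultimately show ?thesis using k by (cases "det ?B = 0") (auto simp: power_0_left)
qed

text \<open>The first \<open>n\<close> columns of an upper triangular \<open>U\<close> vanish below
  row \<open>n - 1\<close>, so the Cauchy-Binet sum collapses to a single product.\<close>

lemma leading_mult_upper:
  assumes "\<And>k j. j < k \<Longrightarrow> U k j = 0"
  shows "leading (\<lambda>i. (L \<cdot> U) (r i)) n = leading (\<lambda>i. L (r i)) n * leading U n"
proof (rule eq_matI)
  fix i j assume "i < dim_row (leading (\<lambda>i. L (r i)) n * leading U n)"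
    "j < dim_col (leading (\<lambda>i. L (r i)) n * leading U n)"
  then have ij: "i < n" "j < n" by (auto simp: leading_def)
  have "(L \<cdot> U) (r i) j = (\<Sum>k\<in>{0..<n}. L (r i) k * U k j)"
    unfolding smat_mult_def using ij assms by (intro suminf_finite_support) auto
  then show "leading (\<lambda>i. (L \<cdot> U) (r i)) n $$ (i, j) =
      (leading (\<lambda>i. L (r i)) n * leading U n) $$ (i, j)"
    using ij by (simp add: leading_def scalar_prod_def)
qed (auto simp: leading_def)

lemma det_leading_upper_bidiag: "det (leading (upper_bidiag d) n) = (\<Prod>i<n. d i)"
  by (subst det_upper_triangular[of _ n])
    (auto simp: prod_list_diag_prod leading_def upper_bidiag_def lessThan_atLeast0)

section \<open>Continuants\<close>

text \<open>The determinant of the tridiagonal matrix of order \<open>j\<close> with diagonal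
  \<open>m k, m (k + 1), \<dots>\<close>, unit superdiagonal and subdiagonal \<open>l (k + 1), l (k + 2), \<dots>\<close>.\<close>

fun continuant :: "(nat \<Rightarrow> real) \<Rightarrow> (nat \<Rightarrow> real) \<Rightarrow> nat \<Rightarrow> nat \<Rightarrow> real" where
  "continuant m l k 0 = 1"
| "continuant m l k (Suc 0) = m k"
| "continuant m l k (Suc (Suc j)) =
     m (k + j + 1) * continuant m l k (Suc j) - l (k + j + 1) * continuant m l k j"

text \<open>The defining recurrence works at the last index, whereas continued fractions unfold at
  the first. Both sides obey the same recurrence at the last index.\<close>

lemma continuant_front:
  "continuant m l k (Suc (Suc j)) =
     m k * continuant m l (Suc k) (Suc j) - l (Suc k) * continuant m l (Suc (Suc k)) j"
proof (induction m l k j rule: continuant.induct)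
  case (3 m l k j)
  have end_step: "continuant m l k (Suc (Suc (Suc (Suc j)))) =
      m (k + Suc (Suc j) + 1) * continuant m l k (Suc (Suc (Suc j)))
      - l (k + Suc (Suc j) + 1) * continuant m l k (Suc (Suc j))"
    "continuant m l (Suc k) (Suc (Suc (Suc j))) =
      m (k + Suc (Suc j) + 1) * continuant m l (Suc k) (Suc (Suc j))
      - l (k + Suc (Suc j) + 1) * continuant m l (Suc k) (Suc j)"
    "continuant m l (Suc (Suc k)) (Suc (Suc j)) =
      m (k + Suc (Suc j) + 1) * continuant m l (Suc (Suc k)) (Suc j)
      - l (k + Suc (Suc j) + 1) * continuant m l (Suc (Suc k)) j"
    by (simp_all only: continuant.simps(3) add_Suc add_Suc_right)
  show ?case unfolding end_step 3 by (simp only: algebra_simps)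
qed (simp_all add: algebra_simps)

text \<open>If a continuant vanished after a positive predecessor, the recurrence would make the
  next one negative.\<close>

lemma continuant_pos:
  assumes nonneg: "\<And>j. continuant m l k j \<ge> 0" and l: "\<And>n. n > k \<Longrightarrow> l n > 0"
  shows "continuant m l k j > 0"
proof (induction j)
  case (Suc j)
  have "continuant m l k (Suc j) \<noteq> 0"
  proof
    assume "continuant m l k (Suc j) = 0"
    then have "continuant m l k (Suc (Suc j)) = - (l (k + j + 1) * continuant m l k j)"
      by simp
    moreover have "l (k + j + 1) * continuant m l k j > 0" using Suc l by simp
    ultimately show False using nonneg[of "Suc (Suc j)"] by linarith
  qed
  then show ?case using nonneg[of "Suc j"] by linarith
qed simp

text \<open>Laplace expansion along the last row, then along the last column of the minor that
  belongs to the off-diagonal entry.\<close>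

lemma det_leading_three_term:
  assumes row: "\<And>j. j < n \<Longrightarrow> A (Suc n) j = 0" and col: "\<And>i. i < n \<Longrightarrow> A i (Suc n) = 0"
  shows "det (leading A (Suc (Suc n))) =
    A (Suc n) (Suc n) * det (leading A (Suc n)) - A (Suc n) n * A n (Suc n) * det (leading A n)"
proof -
  let ?M = "leading A (Suc (Suc n))"
  define D where "D = mat_delete ?M (Suc n) n"
  have D: "D \<in> carrier_mat (Suc n) (Suc n)"
    using mat_delete_carrier[OF leading_carrier, of A "Suc (Suc n)"] by (simp add: D_def)
  have "det D = (\<Sum>i<Suc n. D $$ (i, n) * cofactor D i n)"
    by (rule laplace_expansion_column[OF D]) simp
  also have "\<dots> = D $$ (n, n) * cofactor D n n"
    by (simp add: D_def mat_delete_def leading_def col)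
  also have "mat_delete D n n = leading A n"
    by (rule eq_matI) (auto simp: D_def mat_delete_def leading_def)
  then have "cofactor D n n = det (leading A n)" by (simp add: cofactor_def)
  also have "D $$ (n, n) = A n (Suc n)" by (simp add: D_def mat_delete_def leading_def)
  finally have detD: "det D = A n (Suc n) * det (leading A n)" .
  have "mat_delete ?M (Suc n) (Suc n) = leading A (Suc n)"
    by (rule eq_matI) (auto simp: mat_delete_def leading_def)
  then have last: "cofactor ?M (Suc n) (Suc n) = det (leading A (Suc n))"
    by (simp add: cofactor_def)
  have "det ?M = (\<Sum>j<Suc (Suc n). ?M $$ (Suc n, j) * cofactor ?M (Suc n) j)"
    by (rule laplace_expansion_row) simp_all
  also have "\<dots> = A (Suc n) n * cofactor ?M (Suc n) n
      + A (Suc n) (Suc n) * cofactor ?M (Suc n) (Suc n)"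
    by (simp add: leading_def row)
  also have "cofactor ?M (Suc n) n = - det D" by (simp add: cofactor_def D_def)
  finally show ?thesis by (simp add: last detD)
qed

text \<open>Deleting row \<open>q\<close> of a unitriangular matrix of bandwidth 2 leaves a block triangular
  matrix whose second diagonal block is tridiagonal.\<close>

lemma det_lower_unitri_skip_row:
  fixes q :: nat
  defines "r \<equiv> \<lambda>i. if i < q then i else Suc i"
  shows "det (leading (\<lambda>i. lower_unitri m l (r i)) (q + j)) = continuant m l (Suc q) j"
proof (induction j rule: less_induct)
  case (less j)
  let ?A = "\<lambda>i. lower_unitri m l (r i)"
  consider "j = 0" | "j = 1" | p where "j = Suc (Suc p)" by (metis One_nat_def not0_implies_Suc)
  then show ?case
  proof cases
    case 1
    have "det (leading ?A q) = prod_list (diag_mat (leading ?A q))"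
      by (rule det_lower_triangular[of q]) (auto simp: leading_def lower_unitri_def r_def)
    then show ?thesis
      using 1 by (simp add: prod_list_diag_prod leading_def lower_unitri_def r_def)
  next
    case 2
    have "det (leading ?A (Suc q)) = prod_list (diag_mat (leading ?A (Suc q)))"
      by (rule det_lower_triangular[of "Suc q"]) (auto simp: leading_def lower_unitri_def r_def)
    then show ?thesis
      using 2 by (simp add: prod_list_diag_prod leading_def lower_unitri_def r_def)
  next
    case 3
    \<comment> \<open>From row \<open>q\<close> on, row \<open>i\<close> of \<open>?A\<close> is row
      \<open>i + 1\<close> of the unitriangular matrix, so its diagonal entry is
      \<open>m (i + 1)\<close>, with \<open>l (i + 1)\<close> to the left (when
      \<open>i > 0\<close>) and 1 to the right.\<close>
    have "det (leading ?A (Suc (Suc (q + p)))) =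
        ?A (Suc (q + p)) (Suc (q + p)) * det (leading ?A (Suc (q + p)))
        - ?A (Suc (q + p)) (q + p) * ?A (q + p) (Suc (q + p)) * det (leading ?A (q + p))"
      by (rule det_leading_three_term) (auto simp: lower_unitri_def r_def)
    then show ?thesis
      using less[of p] less[of "Suc p"] 3 by (simp add: lower_unitri_def r_def)
  qed
qed

lemma strict_mono_skip: "strict_mono (\<lambda>i::nat. if i < q then i else Suc i)"
  by (auto simp: strict_mono_def)

lemma oscillatory_continuant_pos:
  assumes osc: "oscillatory T" and T: "T = lower_unitri m l \<cdot> upper_bidiag d"
    and d: "\<And>n. d n > 0" and l: "\<And>n. n \<ge> 2 \<Longrightarrow> l n > 0" and k: "k \<ge> 1"
  shows "continuant m l k j > 0"
proof (rule continuant_pos)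
  obtain q where q: "k = Suc q" using k by (cases k) auto
  let ?r = "\<lambda>i. if i < q then i else Suc i"
  fix j
  \<comment> \<open>The selected rows skip \<open>q\<close> and reach at most \<open>q + j\<close>,
    hence the order \<open>Suc (q + j)\<close>.\<close>
  have "TN (leading T (Suc (q + j)))"
    using osc unfolding oscillatory_def oscillatory_mat_def by blast
  then have "det (leading (\<lambda>i. T (?r i)) (q + j)) \<ge> 0"
    by (rule TN_leading_det_nonneg[OF _ strict_mono_skip]) auto
  also have "leading (\<lambda>i. T (?r i)) (q + j) =
      leading (\<lambda>i. lower_unitri m l (?r i)) (q + j) * leading (upper_bidiag d) (q + j)"
    unfolding T by (rule leading_mult_upper) (simp add: upper_bidiag_def)
  also have "det \<dots> = continuant m l k j * (\<Prod>i<q + j. d i)"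
    by (simp add: det_mult[OF leading_carrier leading_carrier] det_lower_unitri_skip_row
        det_leading_upper_bidiag q)
  finally show "continuant m l k j \<ge> 0"
    using prod_pos[of "{..<q + j}" d] d by (simp add: zero_le_mult_iff)
qed (use l k in auto)

section \<open>Convergence of the continued fractions\<close>

lemma cfrac_self [simp]: "cfrac T k k = gb_m T k"
  by (subst cfrac.simps) simp

lemma cfrac_step: "k < n \<Longrightarrow> cfrac T n k = gb_m T k - gb_l T (Suc k) / cfrac T n (Suc k)"
  by (subst cfrac.simps) simp

text \<open>Dividing \<open>continuant_front\<close> by the continuant at \<open>Suc k\<close> gives
  one step of the continued fraction; positivity keeps the denominators nonzero.\<close>

lemma cfrac_continuant:
  assumes "\<And>k j. k \<ge> 1 \<Longrightarrow> continuant (gb_m T) (gb_l T) k j > 0" "k \<ge> 1"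
  shows "cfrac T (k + j) k =
    continuant (gb_m T) (gb_l T) k (Suc j) / continuant (gb_m T) (gb_l T) (Suc k) j"
  using assms(2)
proof (induction j arbitrary: k)
  case (Suc j)
  have "continuant (gb_m T) (gb_l T) (Suc k) (Suc j) > 0" by (rule assms(1)) simp
  then show ?case
    using Suc.IH[of "Suc k"] unfolding continuant_front
    by (subst cfrac_step) (auto simp: field_simps)
qed simp

locale positive_cfrac =
  fixes T :: smat
  assumes l_pos: "n \<ge> 2 \<Longrightarrow> gb_l T n > 0"
    and continuant_pos: "k \<ge> 1 \<Longrightarrow> continuant (gb_m T) (gb_l T) k j > 0"
begin

lemma cfrac_pos: "k \<ge> 1 \<Longrightarrow> k \<le> n \<Longrightarrow> cfrac T n k > 0"
  using cfrac_continuant[OF continuant_pos, of k "n - k"] continuant_pos[of k "Suc (n - k)"]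
    continuant_pos[of "Suc k" "n - k"] by simp

text \<open>Lengthening the fraction subtracts a positive quantity from its innermost term, and each
  enclosing map \<open>x \<mapsto> m - l / x\<close> is increasing on positive
  \<open>x\<close>.\<close>

lemma cfrac_decreasing: "k \<ge> 1 \<Longrightarrow> cfrac T (Suc (k + j)) k \<le> cfrac T (k + j) k"
proof (induction j arbitrary: k)
  case 0
  then show ?case
    using l_pos[of "Suc k"] cfrac_pos[of "Suc k" "Suc k"] by (simp add: cfrac_step)
next
  case (Suc j)
  have "cfrac T (Suc (k + Suc j)) (Suc k) \<le> cfrac T (k + Suc j) (Suc k)"
    using Suc.IH[of "Suc k"] by simp
  moreover have "cfrac T (Suc (k + Suc j)) (Suc k) > 0" by (rule cfrac_pos) auto
  moreover have "gb_l T (Suc k) > 0" using Suc.prems by (intro l_pos) simp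
  ultimately show ?case by (auto simp: cfrac_step intro!: divide_left_mono mult_pos_pos)
qed

lemma cfrac_tendsto:
  assumes "k \<ge> 1"
  shows "(\<lambda>n. cfrac T n k) \<longlonglongrightarrow> cfrac_lim T k"
proof -
  have "decseq (\<lambda>j. cfrac T (j + k) k)"
    using cfrac_decreasing[OF assms] by (auto simp: decseq_Suc_iff add.commute)
  moreover have "cfrac T (j + k) k \<ge> 0" for j
    using cfrac_pos[of k "j + k"] assms by simp
  ultimately obtain x where "(\<lambda>j. cfrac T (j + k) k) \<longlonglongrightarrow> x"
    by (metis decseq_convergent)
  then have "(\<lambda>n. cfrac T n k) \<longlonglongrightarrow> x" by (rule LIMSEQ_offset)
  then show ?thesis by (simp add: cfrac_lim_def limI)
qed

lemma cfrac_lim_nonneg: "k \<ge> 1 \<Longrightarrow> cfrac_lim T k \<ge> 0"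
  by (rule LIMSEQ_le_const[OF cfrac_tendsto]) (meson cfrac_pos less_imp_le)+

text \<open>Only proper tails have a strictly positive value: \<open>\<K>[k+1] = 0\<close> would force
  \<open>\<K>[n,k] < 0\<close> for large \<open>n\<close>, but nothing excludes \<open>\<K>[1] = 0\<close>.\<close>

lemma cfrac_lim_tail_pos:
  assumes "k \<ge> 1"
  shows "cfrac_lim T (Suc k) > 0"
proof -
  \<comment> \<open>Positivity of \<open>cfrac T n k\<close>, cleared of its denominator so that the
    limit can be taken before it is known to be nonzero.\<close>
  have ev: "\<forall>n\<ge>Suc k. gb_l T (Suc k) \<le> gb_m T k * cfrac T n (Suc k)"
  proof (intro allI impI)
    fix n assume n: "n \<ge> Suc k"
    then have "cfrac T n (Suc k) > 0" "cfrac T n k > 0" using cfrac_pos assms by auto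
    then show "gb_l T (Suc k) \<le> gb_m T k * cfrac T n (Suc k)"
      using n by (simp add: cfrac_step field_simps)
  qed
  have "(\<lambda>n. gb_m T k * cfrac T n (Suc k)) \<longlonglongrightarrow> gb_m T k * cfrac_lim T (Suc k)"
    by (intro tendsto_mult_left cfrac_tendsto) simp
  then have "gb_l T (Suc k) \<le> gb_m T k * cfrac_lim T (Suc k)"
    by (rule LIMSEQ_le_const) (use ev in blast)
  moreover have "gb_l T (Suc k) > 0" using assms by (intro l_pos) simp
  ultimately have "cfrac_lim T (Suc k) \<noteq> 0" by auto
  then show ?thesis using cfrac_lim_nonneg[of "Suc k"] by simp
qed

text \<open>The finite recursion passes to the limit because the tail in the denominator has a
  nonzero limit.\<close>

lemma cfrac_lim_step:
  assumes "k \<ge> 1"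
  shows "cfrac_lim T k = gb_m T k - gb_l T (Suc k) / cfrac_lim T (Suc k)"
proof (rule LIMSEQ_unique[OF cfrac_tendsto[OF assms]])
  have "(\<lambda>n. gb_m T k - gb_l T (Suc k) / cfrac T n (Suc k))
      \<longlonglongrightarrow> gb_m T k - gb_l T (Suc k) / cfrac_lim T (Suc k)"
    using cfrac_lim_tail_pos[OF assms] by (intro tendsto_intros cfrac_tendsto) auto
  moreover have "\<forall>\<^sub>F n in sequentially.
      cfrac T n k = gb_m T k - gb_l T (Suc k) / cfrac T n (Suc k)"
    using eventually_gt_at_top[of k] by eventually_elim (rule cfrac_step)
  ultimately show "(\<lambda>n. cfrac T n k)
      \<longlonglongrightarrow> gb_m T k - gb_l T (Suc k) / cfrac_lim T (Suc k)"
    by (simp add: tendsto_cong)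
qed

end

section \<open>Matrices with a shifted Gauss--Borel factorization\<close>

lemma lower_bidiag_mult:
  "lower_bidiag x \<cdot> lower_bidiag y = lower_unitri (\<lambda>n. x n + y n) (\<lambda>n. x n * y (n - 1))"
proof (intro ext)
  fix i j
  have "(lower_bidiag x \<cdot> lower_bidiag y) i j =
      (\<Sum>k\<in>{j, Suc j}. lower_bidiag x i k * lower_bidiag y k j)"
    unfolding smat_mult_def by (rule suminf_finite_support) (auto simp: lower_bidiag_def)
  then show "(lower_bidiag x \<cdot> lower_bidiag y) i j =
      lower_unitri (\<lambda>n. x n + y n) (\<lambda>n. x n * y (n - 1)) i j"
    by (auto simp: lower_bidiag_def lower_unitri_def)
qed

lemma lower_unitri_cong:
  assumes "\<And>n. n \<ge> 1 \<Longrightarrow> m n = m' n" "\<And>n. n \<ge> 2 \<Longrightarrow> l n = l' n"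
  shows "lower_unitri m l = lower_unitri m' l'"
  by (intro ext) (auto simp: lower_unitri_def assms)

text \<open>Bidiagonal factors with subdiagonals \<open>x\<close> and \<open>y\<close> must satisfy
  \<open>x n + y n = m n\<close> and \<open>x n * y (n - 1) = l n\<close>, with \<open>m\<close> and
  \<open>l\<close> the shifted coefficients. The limiting recurrence solves both, with
  \<open>x n\<close> a tail value.\<close>

lemma (in positive_cfrac) shifted_factorization:
  assumes S: "S = tetra_hess a' b' c'"
    and LU: "S = lower_unitri (\<lambda>n. gb_m T (n + s)) (\<lambda>n. gb_l T (n + s)) \<cdot>
      upper_bidiag (\<lambda>n. gb_diag T (n + s))"
    and d: "\<And>n. gb_diag T n > 0" and s: "s \<ge> 1"
  shows "has_PBF S" "convergent (\<lambda>n. cfrac T n (Suc s))" "convergent (\<lambda>n. cfrac S n 1)"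
    "cfrac_lim S 1 = cfrac_lim T (Suc s)"
proof -
  define K where "K = (\<lambda>n. cfrac_lim T n)"
  \<comment> \<open>As \<open>s \<ge> 1\<close>, the index is at least 2, so only proper tails
    occur.\<close>
  have K_pos: "K (n + s) > 0" if "n \<ge> 1" for n
    using cfrac_lim_tail_pos[of "n + s - 1"] that s by (simp add: K_def)
  have l: "gb_l T (n + s) > 0" if "n \<ge> 1" for n
    using that s by (intro l_pos) simp
  \<comment> \<open>For \<open>j = 3 p + 2 = 3 n - 1\<close> the \<open>Suc\<close> gives
    \<open>n = p + 1\<close>; for \<open>j = 3 n\<close> it comes from the quotient
    \<open>l / K\<close> at index \<open>n + 1\<close>.\<close>
  define \<alpha> where "\<alpha> = (\<lambda>j. if j mod 3 = 2 then K (Suc (j div 3) + s)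
    else if j mod 3 = 0 then gb_l T (Suc (j div 3) + s) / K (Suc (j div 3) + s)
    else gb_diag T (j div 3 + s))"
  have \<alpha>_pos: "\<alpha> j > 0" for j
    using K_pos l d unfolding \<alpha>_def by (auto simp del: add_Suc)
  have \<alpha>2: "\<alpha> (3 * n - 1) = K (n + s)" if "n \<ge> 1" for n
  proof -
    obtain p where "n = Suc p" using \<open>n \<ge> 1\<close> by (cases n) auto
    moreover have "(3 * p + 2) mod 3 = 2" "(3 * p + 2) div 3 = p" by presburger+
    ultimately show ?thesis by (simp add: \<alpha>_def)
  qed
  have \<alpha>0: "\<alpha> (3 * n) = gb_l T (Suc n + s) / K (Suc n + s)" for n
    by (simp add: \<alpha>_def)
  have \<alpha>1: "\<alpha> (3 * n + 1) = gb_diag T (n + s)" for n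
  proof -
    have "(3 * n + 1) mod 3 = 1" "(3 * n + 1) div 3 = n" by presburger+
    then show ?thesis by (simp add: \<alpha>_def)
  qed
  have "lower_bidiag (\<lambda>n. \<alpha> (3 * n - 1)) \<cdot> lower_bidiag (\<lambda>n. \<alpha> (3 * n)) =
      lower_unitri (\<lambda>n. gb_m T (n + s)) (\<lambda>n. gb_l T (n + s))"
    unfolding lower_bidiag_mult
  \<comment> \<open>Restricting to \<open>n \<ge> 1\<close> avoids \<open>n = 0\<close>, where
    \<open>3 * n - 1\<close> is truncated to 0.\<close>
  proof (rule lower_unitri_cong)
    fix n :: nat assume n: "n \<ge> 1"
    show "\<alpha> (3 * n - 1) + \<alpha> (3 * n) = gb_m T (n + s)"
      using cfrac_lim_step[of "n + s"] n unfolding \<alpha>2[OF n] \<alpha>0 by (simp add: K_def)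
  next
    fix n :: nat assume n: "n \<ge> 2"
    then have "\<alpha> (3 * (n - 1)) = gb_l T (n + s) / K (n + s)" by (subst \<alpha>0) simp
    moreover have "\<alpha> (3 * n - 1) = K (n + s)" using n by (intro \<alpha>2) simp
    ultimately show "\<alpha> (3 * n - 1) * \<alpha> (3 * (n - 1)) = gb_l T (n + s)"
      using n K_pos[of n] by simp
  qed
  then have "S = lower_bidiag (\<lambda>n. \<alpha> (3 * n - 1)) \<cdot> lower_bidiag (\<lambda>n. \<alpha> (3 * n)) \<cdot>
      upper_bidiag (\<lambda>n. \<alpha> (3 * n + 1))"
    by (simp only: LU \<alpha>1)
  then show "has_PBF S" using \<alpha>_pos unfolding has_PBF_def by (intro exI[of _ \<alpha>] conjI) auto
  have nz: "gb_diag T (n + s) \<noteq> 0" for n using d[of "n + s"] by simp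
  note u = gauss_borel_unique[OF S LU nz]
  \<comment> \<open>By uniqueness of the Gauss-Borel factorization the coefficients of
    \<open>S\<close> are those of \<open>T\<close> shifted by \<open>s\<close>, so already the
    finite fractions agree.\<close>
  have shift: "cfrac S (k + j) k = cfrac T (k + j + s) (k + s)" if "k \<ge> 1" for k j
    using that
  proof (induction j arbitrary: k)
    case 0
    then show ?case using u(2)[of k] by simp
  next
    case (Suc j)
    then show ?case
      using u(2)[of k] u(3)[of "Suc k"] Suc.IH[of "Suc k"] by (simp add: cfrac_step)
  qed
  have T_lim: "(\<lambda>n. cfrac T n (Suc s)) \<longlonglongrightarrow> K (Suc s)"
    unfolding K_def by (rule cfrac_tendsto) simp
  then show "convergent (\<lambda>n. cfrac T n (Suc s))" by (rule convergentI)
  have "(\<lambda>j. cfrac S (j + 1) 1) \<longlonglongrightarrow> K (Suc s)"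
    using LIMSEQ_ignore_initial_segment[OF T_lim, of "Suc s"] shift[of 1]
    by (simp add: add.commute add.left_commute)
  then have S_lim: "(\<lambda>n. cfrac S n 1) \<longlonglongrightarrow> K (Suc s)" by (rule LIMSEQ_offset)
  then show "convergent (\<lambda>n. cfrac S n 1)" by (rule convergentI)
  show "cfrac_lim S 1 = cfrac_lim T (Suc s)"
    using S_lim by (simp add: cfrac_lim_def[of S] K_def limI)
qed

theorem theorem12:
  fixes a b c :: "nat \<Rightarrow> real" and T :: smat
  assumes T: "T = tetra_hess a b c"
    and a_pos: "\<forall>n\<ge>2. a n > 0"
    and osc: "oscillatory T"
  shows "(has_PBF (tail_first a b c) \<and>
          convergent (\<lambda>n. cfrac T n 2) \<and>
          convergent (\<lambda>n. cfrac (tail_first a b c) n 1) \<and>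
          cfrac_lim (tail_first a b c) 1 = cfrac_lim T 2) \<and>
         (\<forall>k\<ge>2.
          has_PBF (tail_next a b c k) \<and>
          convergent (\<lambda>n. cfrac T n (k + 1)) \<and>
          convergent (\<lambda>n. cfrac (tail_next a b c k) n 1) \<and>
          cfrac_lim (tail_next a b c k) 1 = cfrac_lim T (k + 1))"
proof -
  have det: "det (leading T n) > 0" for n by (rule oscillatory_det_pos[OF osc])
  define d m l where "d = gb_diag T" and "m = gb_m T" and "l = gb_l T"
  have d: "d n > 0" for n using det by (simp add: d_def gb_diag_def)
  have "det (leading T n) \<noteq> 0" for n using det[of n] by simp
  then have LU: "T = lower_unitri m l \<cdot> upper_bidiag d"
    unfolding d_def m_def l_def by (rule gauss_borel_factorization[OF T])
  have entry: "tetra_hess a b c i j = (lower_unitri m l \<cdot> upper_bidiag d) i j" for i j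
    using T LU by simp
  have c0: "c 0 = d 0" using entry[of 0 0] by (simp add: tetra_hess_def lower_upper_entry)
  have c: "c n = m n + d n" if "n \<ge> 1" for n
    using entry[of n n] that by (simp add: tetra_hess_def lower_upper_entry)
  have b1: "b 1 = m 1 * d 0" using entry[of 1 0] by (simp add: tetra_hess_def lower_upper_entry)
  have b: "b (Suc n) = m (Suc n) * d n + l (Suc n)" if "n \<ge> 1" for n
    using entry[of "Suc n" n] that by (simp add: tetra_hess_def lower_upper_entry)
  have a: "a (Suc (Suc n)) = l (Suc (Suc n)) * d n" for n
    using entry[of "Suc (Suc n)" n] by (simp add: tetra_hess_def lower_upper_entry)
  have l_pos: "l n > 0" if "n \<ge> 2" for n
  proof -
    obtain p where p: "n = Suc (Suc p)" using le_Suc_ex[OF \<open>n \<ge> 2\<close>] by auto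
    then have "l n * d p > 0" using a_pos[rule_format, of n] a[of p] \<open>n \<ge> 2\<close> by simp
    then show ?thesis using d[of p] by (simp add: zero_less_mult_iff)
  qed
  interpret positive_cfrac T
    using l_pos oscillatory_continuant_pos[OF osc LU d l_pos]
    by unfold_locales (auto simp: m_def l_def)
  have d': "gb_diag T n > 0" for n using d by (simp add: d_def)
  \<comment> \<open>Here \<open>b 1 / c 0 = m 1\<close> and \<open>a 2 / c 0 = l 2\<close>, so the
    two modified entries are \<open>d 1\<close> and \<open>m 2 * d 1\<close>: the shifted product
    has no \<open>l\<close> term in its first column.\<close>
  have first: "tail_first a b c =
      lower_unitri (\<lambda>n. m (n + 1)) (\<lambda>n. l (n + 1)) \<cdot> upper_bidiag (\<lambda>n. d (n + 1))"
  proof (intro ext)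
    fix i j
    have nz: "d 0 \<noteq> 0" using d[of 0] by simp
    show "tail_first a b c i j =
        (lower_unitri (\<lambda>n. m (n + 1)) (\<lambda>n. l (n + 1)) \<cdot> upper_bidiag (\<lambda>n. d (n + 1))) i j"
      using nz c[of 1] b[of 1] a[of 0] b1 c0
      by (auto simp: tail_first_def tetra_hess_def lower_upper_entry a b c numeral_2_eq_2)
  qed
  \<comment> \<open>Since \<open>c (k + 1) - d (k + 1) = m (k + 1)\<close>, the modified entries are
    \<open>d k\<close> and \<open>m (k + 1) * d k\<close>, as in a factorization starting at index
    \<open>k\<close>.\<close>
  have later: "tail_next a b c k =
      lower_unitri (\<lambda>n. m (n + k)) (\<lambda>n. l (n + k)) \<cdot> upper_bidiag (\<lambda>n. d (n + k))"
    if k: "k \<ge> 2" for k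
    unfolding tail_next_def Let_def T[symmetric] d_def[symmetric]
    using k by (intro ext) (auto simp: tetra_hess_def lower_upper_entry a b c)
  show ?thesis
  proof (intro conjI allI impI)
    note f = shifted_factorization[OF tail_first_def first[unfolded d_def m_def l_def] d' order_refl]
    show "has_PBF (tail_first a b c)" "convergent (\<lambda>n. cfrac T n 2)"
      "convergent (\<lambda>n. cfrac (tail_first a b c) n 1)"
      "cfrac_lim (tail_first a b c) 1 = cfrac_lim T 2"
      using f by (simp_all add: numeral_2_eq_2)
  next
    fix k :: nat assume k: "k \<ge> 2"
    note f = shifted_factorization[OF tail_next_def[unfolded Let_def]
      later[OF k, unfolded d_def m_def l_def] d' order_trans[OF one_le_numeral k]]
    show "has_PBF (tail_next a b c k)" "convergent (\<lambda>n. cfrac T n (k + 1))"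
      "convergent (\<lambda>n. cfrac (tail_next a b c k) n 1)"
      "cfrac_lim (tail_next a b c k) 1 = cfrac_lim T (k + 1)"
      using f by simp_all
  qed
qed

end
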